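(* Let $q,\alpha,z$ be complex numbers with $|q|<1$, $\alpha\neq 0$, and such that $-zq^{2k+1}\neq 1$ and $zq^{2k+1}\neq\alpha$ for all integers $k\ge 0$. Then $$\nu(\alpha,z;q)=\frac{1}{(-zq;q^2)_{\infty}(zq/\alpha;q^{2})_{\infty}}\sum_{n=0}^{\infty}\alpha^nq^{n^2+n}-\frac{zq}{\alpha}\,\omega_{1}(\alpha,z;q).$$
   Context: Notation: $(a;q)_n=\prod_{m=0}^{n-1}(1-aq^m)$, $(a;q)_0=1$, $(a;q)_\infty=\prod_{m=0}^{\infty}(1-aq^m)$ for $|q|<1$. Definitions: $$\omega_{1}(\alpha,z;q)=\sum_{n=0}^{\infty}\frac{q^{2n}}{(-zq;q^2)_{n+1}(zq/\alpha;q^{2})_{n+1}},\qquad \nu(\alpha,z;q)=\sum_{n=0}^{\infty}\frac{\alpha^{n}q^{n^{2}+n}}{(-zq;q^2)_{n+1}}.$$ *)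

theory Defs
  imports "HOL-Analysis.Analysis"
begin

definition qpoch :: "complex \<Rightarrow> complex \<Rightarrow> nat \<Rightarrow> complex" where
  "qpoch a q n = (\<Prod>m<n. 1 - a * q ^ m)"

definition qpoch_inf :: "complex \<Rightarrow> complex \<Rightarrow> complex" where
  "qpoch_inf a q = (\<Prod>m. 1 - a * q ^ m)"

definition omega1 :: "complex \<Rightarrow> complex \<Rightarrow> complex \<Rightarrow> complex" where
  "omega1 \<alpha> z q =
     (\<Sum>n. q ^ (2 * n) / (qpoch (- z * q) (q\<^sup>2) (n + 1) * qpoch (z * q / \<alpha>) (q\<^sup>2) (n + 1)))"

definition nu :: "complex \<Rightarrow> complex \<Rightarrow> complex \<Rightarrow> complex" where
  "nu \<alpha> z q = (\<Sum>n. \<alpha> ^ n * q ^ (n\<^sup>2 + n) / qpoch (- z * q) (q\<^sup>2) (n + 1))"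

end

theory Submission
  imports Defs
begin

text \<open>
  Put \<open>b = z q / \<alpha>\<close>, \<open>Q = q\<^sup>2\<close>, and let \<open>P\<^sub>k\<close> be the product of the two finite
  \<open>Q\<close>-Pochhammer symbols of length \<open>k\<close> with parameters \<open>-z q\<close> and \<open>b\<close>.  The series \<open>\<nu>\<close>
  satisfies a first-order recurrence in \<open>z\<close> (\<open>nu_shift\<close>),
    \<open>\<nu>(\<alpha>, z Q) = (1 + z q) (1 - b) \<nu>(\<alpha>, z) + b\<close>.
  Applied at \<open>z Q^k\<close>, where \<open>b\<close> becomes \<open>b Q^k\<close>, and divided by \<open>P\<^sub>k\<^sub>+\<^sub>1\<close>, it reads
    \<open>\<nu>(\<alpha>, z Q^k) / P\<^sub>k - \<nu>(\<alpha>, z Q^(k+1)) / P\<^sub>k\<^sub>+\<^sub>1 = - b Q^k / P\<^sub>k\<^sub>+\<^sub>1\<close>.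
  The right-hand sides are the terms of \<open>\<omega>\<^sub>1\<close> up to the factor \<open>-b\<close>, so summation over \<open>k\<close>
  telescopes to \<open>\<nu>(\<alpha>, z) = lim \<nu>(\<alpha>, z Q^k) / P\<^sub>k - b \<omega>\<^sub>1\<close>.  As \<open>k\<close> grows, \<open>P\<^sub>k\<close> tends to the
  product of the two infinite symbols, which is not zero, and \<open>\<nu>(\<alpha>, z Q^k)\<close> tends to
  its value at \<open>z = 0\<close>, the partial theta series \<open>\<Sum> \<alpha>^n q^(n\<^sup>2+n)\<close> (\<open>nu_tendsto\<close>).
\<close>

section \<open>Finite and infinite q-Pochhammer symbols\<close>

lemma qpoch_Suc: "qpoch a q (Suc n) = qpoch a q n * (1 - a * q ^ n)"
  by (simp add: qpoch_def)

lemma qpoch_add: "qpoch a q (m + n) = qpoch a q m * qpoch (a * q ^ m) q n"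
  by (induction n) (simp_all add: qpoch_def power_add mult_ac)

lemma qpoch_Suc_shift: "qpoch a q (Suc n) = (1 - a) * qpoch (a * q) q n"
  using qpoch_add[of a q 1 n] by (simp add: qpoch_def)

lemma qpoch_nonzero:
  assumes "\<And>m. a * q ^ m \<noteq> 1"
  shows "qpoch a q n \<noteq> 0"
  using assms by (auto simp: qpoch_def)

lemma convergent_prod_qpoch:
  fixes a q :: complex
  assumes "norm q < 1"
  shows "convergent_prod (\<lambda>m. 1 - a * q ^ m)"
proof -
  have "summable (\<lambda>m. norm a * norm q ^ m)"
    using assms by (intro summable_mult summable_geometric) simp
  then show ?thesis
    by (intro abs_convergent_prod_imp_convergent_prod summable_imp_abs_convergent_prod)
      (simp add: norm_mult norm_power)
qed

lemma qpoch_tendsto: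
  assumes "norm q < 1"
  shows "qpoch a q \<longlonglongrightarrow> qpoch_inf a q"
proof -
  have "(\<lambda>n. qpoch a q (Suc n)) \<longlonglongrightarrow> qpoch_inf a q"
    using convergent_prod_LIMSEQ[OF convergent_prod_qpoch[OF assms]]
    by (simp add: qpoch_def qpoch_inf_def lessThan_Suc_atMost)
  then show ?thesis
    by (rule LIMSEQ_imp_Suc)
qed

lemma qpoch_inf_nonzero:
  assumes "norm q < 1" "\<And>m. a * q ^ m \<noteq> 1"
  shows "qpoch_inf a q \<noteq> 0"
  unfolding qpoch_inf_def
  using assms by (intro prodinf_nonzero convergent_prod_qpoch) auto

text \<open>
  Since \<open>(a Q^k; Q)\<^sub>n = (a; Q)\<^sub>k\<^sub>+\<^sub>n / (a; Q)\<^sub>k\<close> and \<open>(a; Q)\<^sub>n\<close> has a nonzero limit, the shifted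
  symbols stay away from zero uniformly in both \<open>k\<close> and \<open>n\<close>.
\<close>

lemma inverse_qpoch_shift_bounded:
  assumes "norm q < 1" and nz: "\<And>m. a * q ^ m \<noteq> 1"
  obtains B where "\<And>k n. norm (1 / qpoch (a * q ^ k) q n) \<le> B"
proof -
  have lim: "qpoch a q \<longlonglongrightarrow> qpoch_inf a q"
    using assms(1) by (rule qpoch_tendsto)
  have "Bseq (qpoch a q)"
    using lim by (meson convergentI convergent_imp_Bseq)
  then obtain K where K: "K > 0" "\<And>n. norm (qpoch a q n) \<le> K"
    by (auto elim: BseqE)
  have "Bseq (\<lambda>n. inverse (qpoch a q n))"
    using tendsto_inverse[OF lim qpoch_inf_nonzero[OF assms]]
    by (meson convergentI convergent_imp_Bseq)
  then obtain L where L: "L > 0" "\<And>n. norm (inverse (qpoch a q n)) \<le> L"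
    by (auto elim: BseqE)
  have "norm (1 / qpoch (a * q ^ k) q n) \<le> K * L" for k n
  proof -
    have "1 / qpoch (a * q ^ k) q n = qpoch a q k * inverse (qpoch a q (k + n))"
      using qpoch_nonzero[of a q k, OF nz] by (simp add: qpoch_add field_simps)
    also have "norm \<dots> \<le> K * L"
      unfolding norm_mult using K L by (intro mult_mono) (auto intro: less_imp_le)
    finally show ?thesis .
  qed
  then show ?thesis
    by (rule that)
qed

lemma qpoch_shift_tendsto_1:
  assumes "norm q < 1" and nz: "\<And>m. a * q ^ m \<noteq> 1"
  shows "(\<lambda>k. qpoch (a * q ^ k) q n) \<longlonglongrightarrow> 1"
proof -
  have "(\<lambda>k. qpoch a q (k + n) / qpoch a q k) \<longlonglongrightarrow> qpoch_inf a q / qpoch_inf a q"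
    using assms by (intro tendsto_divide LIMSEQ_ignore_initial_segment qpoch_tendsto
        qpoch_inf_nonzero)
  moreover have "qpoch a q (k + n) / qpoch a q k = qpoch (a * q ^ k) q n" for k
    using qpoch_nonzero[of a q k, OF nz] by (simp add: qpoch_add)
  ultimately show ?thesis
    using qpoch_inf_nonzero[OF assms] by simp
qed

section \<open>The partial theta series\<close>

lemma theta_coeff_Suc:
  "\<alpha> ^ Suc n * q ^ ((Suc n)\<^sup>2 + Suc n) = \<alpha> * (q\<^sup>2) ^ Suc n * (\<alpha> ^ n * q ^ (n\<^sup>2 + n))"
  for q \<alpha> :: complex
proof -
  have "(Suc n)\<^sup>2 + Suc n = 2 * Suc n + (n\<^sup>2 + n)"
    by (simp add: power2_eq_square)
  then have "q ^ ((Suc n)\<^sup>2 + Suc n) = (q\<^sup>2) ^ Suc n * q ^ (n\<^sup>2 + n)"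
    by (simp only: power_add power_mult)
  then show ?thesis
    by simp
qed

lemma summable_norm_theta:
  fixes q \<alpha> :: complex
  assumes "norm q < 1"
  shows "summable (\<lambda>n. norm (\<alpha> ^ n * q ^ (n\<^sup>2 + n)))"
proof -
  have "(\<lambda>n. norm (\<alpha> * (q\<^sup>2) ^ Suc n)) \<longlonglongrightarrow> 0"
  proof -
    have "(\<lambda>n. (q\<^sup>2) ^ Suc n) \<longlonglongrightarrow> 0"
      using assms by (intro LIMSEQ_Suc LIMSEQ_power_zero) (simp add: norm_power power_less_one_iff)
    then show ?thesis
      by (intro tendsto_norm_zero tendsto_mult_right_zero)
  qed
  then have "\<forall>\<^sub>F n in sequentially. norm (\<alpha> * (q\<^sup>2) ^ Suc n) < 1 / 2"
    by (rule order_tendstoD) simp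
  then obtain N where N: "\<And>n. n \<ge> N \<Longrightarrow> norm (\<alpha> * (q\<^sup>2) ^ Suc n) < 1 / 2"
    by (auto simp: eventually_sequentially)
  show ?thesis
  proof (rule summable_ratio_test[of "1 / 2" N])
    fix n assume "n \<ge> N"
    then have "norm (\<alpha> * (q\<^sup>2) ^ Suc n) * norm (\<alpha> ^ n * q ^ (n\<^sup>2 + n))
        \<le> 1 / 2 * norm (\<alpha> ^ n * q ^ (n\<^sup>2 + n))"
      by (intro mult_right_mono[OF less_imp_le[OF N]] norm_ge_zero)
    then show "norm (norm (\<alpha> ^ Suc n * q ^ ((Suc n)\<^sup>2 + Suc n)))
        \<le> 1 / 2 * norm (norm (\<alpha> ^ n * q ^ (n\<^sup>2 + n)))"
      unfolding theta_coeff_Suc norm_mult[of "\<alpha> * (q\<^sup>2) ^ Suc n"] by (simp only: norm_mult real_norm_def abs_mult abs_norm_cancel)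
  qed simp
qed

section \<open>The series nu under the shift of z by the base\<close>

lemma norm_square_less_one: "norm q < 1 \<Longrightarrow> norm (q\<^sup>2) < 1" for q :: complex
  by (simp add: norm_power power_less_one_iff)

lemma summable_nu:
  assumes q: "norm q < 1" and nz: "\<And>m. - z * q * (q\<^sup>2) ^ m \<noteq> 1"
  shows "summable (\<lambda>n. \<alpha> ^ n * q ^ (n\<^sup>2 + n) / qpoch (- z * q) (q\<^sup>2) (n + 1))"
proof -
  obtain B where B: "\<And>k n. norm (1 / qpoch (- z * q * (q\<^sup>2) ^ k) (q\<^sup>2) n) \<le> B"
    using inverse_qpoch_shift_bounded[OF norm_square_less_one[OF q] nz] by metis
  have "norm (\<alpha> ^ n * q ^ (n\<^sup>2 + n) / qpoch (- z * q) (q\<^sup>2) (n + 1))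
      \<le> norm (\<alpha> ^ n * q ^ (n\<^sup>2 + n)) * B" for n
    using mult_left_mono[OF B[of 0 "n + 1"], of "norm (\<alpha> ^ n * q ^ (n\<^sup>2 + n))"]
    by (simp add: norm_mult norm_divide)
  then show ?thesis
    by (intro summable_comparison_test'[OF summable_mult2[OF summable_norm_theta[OF q]]])
qed

text \<open>
  Multiplication of \<open>\<nu>(\<alpha>, z)\<close> by \<open>1 + z q\<close> removes the first factor from every denominator,
  so that the \<open>n\<close>-th term and that of \<open>\<nu>(\<alpha>, z q\<^sup>2)\<close> have the denominators \<open>(-z q\<^sup>3; q\<^sup>2)\<^sub>n\<close> and
  \<open>(-z q\<^sup>3; q\<^sup>2)\<^sub>n\<^sub>+\<^sub>1\<close>.  Their difference is again a term of \<open>(1 + z q) \<nu>(\<alpha>, z)\<close>, namely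
  \<open>z q / \<alpha>\<close> times the one of index \<open>n + 1\<close>.
\<close>

lemma nu_shift:
  assumes q: "norm q < 1" and \<alpha>: "\<alpha> \<noteq> 0" and nz: "\<And>m. - z * q * (q\<^sup>2) ^ m \<noteq> 1"
  shows "nu \<alpha> (z * q\<^sup>2) q = (1 + z * q) * (1 - z * q / \<alpha>) * nu \<alpha> z q + z * q / \<alpha>"
proof -
  define X where "X = - (z * q\<^sup>2) * q"
  have X: "X = - z * q * q\<^sup>2"
    by (simp add: X_def)
  have nzX: "X * (q\<^sup>2) ^ m \<noteq> 1" for m
    using nz[of "Suc m"] by (simp add: X mult.assoc)
  have nz0: "1 + z * q \<noteq> 0"
    using nz[of 0] by (auto simp: add_eq_0_iff)
  define c where "c n = \<alpha> ^ n * q ^ (n\<^sup>2 + n)" for n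
  define t where "t n = c n / qpoch X (q\<^sup>2) n" for n
  have summand: "c n / qpoch (- z * q) (q\<^sup>2) (n + 1) = t n / (1 + z * q)" for n
    using qpoch_Suc_shift[of "- z * q" "q\<^sup>2" n] by (simp add: t_def X)
  have "(\<lambda>n. t n / (1 + z * q)) sums nu \<alpha> z q"
    using summable_sums[OF summable_nu[OF q nz, of \<alpha>]] summand by (simp add: nu_def c_def)
  then have t_sums: "t sums ((1 + z * q) * nu \<alpha> z q)"
    using sums_mult[of "\<lambda>n. t n / (1 + z * q)" _ "1 + z * q"] nz0 by simp
  have "(\<lambda>n. c n / qpoch X (q\<^sup>2) (n + 1)) sums nu \<alpha> (z * q\<^sup>2) q"
    using summable_sums[OF summable_nu[OF q nzX[unfolded X_def], of \<alpha>]]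
    by (simp add: nu_def c_def X_def)
  from sums_diff[OF t_sums this]
  have "(\<lambda>n. t n - c n / qpoch X (q\<^sup>2) (n + 1)) sums
      ((1 + z * q) * nu \<alpha> z q - nu \<alpha> (z * q\<^sup>2) q)" .
  moreover have "t n - c n / qpoch X (q\<^sup>2) (n + 1) = z * q / \<alpha> * t (Suc n)" for n
  proof -
    have c: "c (Suc n) = \<alpha> * (q\<^sup>2) ^ Suc n * c n"
      unfolding c_def by (rule theta_coeff_Suc)
    have "t n - c n / qpoch X (q\<^sup>2) (n + 1)
        = c n * (1 - X * (q\<^sup>2) ^ n - 1) / qpoch X (q\<^sup>2) (Suc n)"
      using qpoch_nonzero[OF nzX, of n] nzX[of n]
      by (simp add: t_def qpoch_Suc divide_simps) (simp add: algebra_simps)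
    also have "\<dots> = z * q / \<alpha> * t (Suc n)"
      using \<alpha> by (simp add: t_def c X)
    finally show ?thesis .
  qed
  ultimately have "(\<lambda>n. z * q / \<alpha> * t (Suc n)) sums
      ((1 + z * q) * nu \<alpha> z q - nu \<alpha> (z * q\<^sup>2) q)"
    by simp
  moreover have "(\<lambda>n. t (Suc n)) sums ((1 + z * q) * nu \<alpha> z q - 1)"
    using t_sums sums_Suc_iff[of t] by (simp add: t_def c_def qpoch_def)
  then have "(\<lambda>n. z * q / \<alpha> * t (Suc n)) sums (z * q / \<alpha> * ((1 + z * q) * nu \<alpha> z q - 1))"
    by (rule sums_mult)
  ultimately have "(1 + z * q) * nu \<alpha> z q - nu \<alpha> (z * q\<^sup>2) q
      = z * q / \<alpha> * ((1 + z * q) * nu \<alpha> z q - 1)"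
    by (rule sums_unique2)
  then show ?thesis
    by (simp add: algebra_simps add_divide_distrib)
qed

text \<open>
  Each denominator tends to \<open>1\<close>, and the uniform bound on the reciprocals makes a multiple
  of the theta series a dominating series, so Tannery's theorem applies.
\<close>

lemma nu_tendsto:
  assumes q: "norm q < 1" and nz: "\<And>m. - z * q * (q\<^sup>2) ^ m \<noteq> 1"
  shows "(\<lambda>k. nu \<alpha> (z * (q\<^sup>2) ^ k) q) \<longlonglongrightarrow> (\<Sum>n. \<alpha> ^ n * q ^ (n\<^sup>2 + n))"
proof -
  define a where "a n k = \<alpha> ^ n * q ^ (n\<^sup>2 + n) / qpoch (- z * q * (q\<^sup>2) ^ k) (q\<^sup>2) (n + 1)" for n k
  obtain B where B: "\<And>k n. norm (1 / qpoch (- z * q * (q\<^sup>2) ^ k) (q\<^sup>2) n) \<le> B"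
    using inverse_qpoch_shift_bounded[OF norm_square_less_one[OF q] nz] by metis
  have bound: "norm (a n k) \<le> norm (\<alpha> ^ n * q ^ (n\<^sup>2 + n)) * B" for n k
    using mult_left_mono[OF B[of k "n + 1"], of "norm (\<alpha> ^ n * q ^ (n\<^sup>2 + n))"]
    by (simp add: a_def norm_mult norm_divide)
  have lim: "a n \<longlonglongrightarrow> \<alpha> ^ n * q ^ (n\<^sup>2 + n)" for n
    using tendsto_divide[OF tendsto_const
        qpoch_shift_tendsto_1[OF norm_square_less_one[OF q] nz, of "n + 1"],
        of "\<alpha> ^ n * q ^ (n\<^sup>2 + n)"]
    by (simp add: a_def[abs_def])
  have "(\<lambda>k. \<Sum>n. a n k) \<longlonglongrightarrow> (\<Sum>n. \<alpha> ^ n * q ^ (n\<^sup>2 + n))"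
    using tannerys_theorem[OF lim always_eventually
        summable_mult2[OF summable_norm_theta[OF q, of \<alpha>], of B]] bound
    by simp
  then show ?thesis
    by (simp add: nu_def a_def mult_ac)
qed

section \<open>Telescoping\<close>

theorem theorem1p1:
  fixes q \<alpha> z :: complex
  assumes "norm q < 1"
    and "\<alpha> \<noteq> 0"
    and "\<And>k::nat. - z * q ^ (2 * k + 1) \<noteq> 1"
    and "\<And>k::nat. z * q ^ (2 * k + 1) \<noteq> \<alpha>"
  shows "nu \<alpha> z q =
    1 / (qpoch_inf (- z * q) (q\<^sup>2) * qpoch_inf (z * q / \<alpha>) (q\<^sup>2)) * (\<Sum>n. \<alpha> ^ n * q ^ (n\<^sup>2 + n))
      - z * q / \<alpha> * omega1 \<alpha> z q"
proof -
  define b where "b = z * q / \<alpha>"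
  define S where "S = (\<Sum>n. \<alpha> ^ n * q ^ (n\<^sup>2 + n))"
  define P where "P k = qpoch (- z * q) (q\<^sup>2) k * qpoch b (q\<^sup>2) k" for k
  define L where "L = qpoch_inf (- z * q) (q\<^sup>2) * qpoch_inf b (q\<^sup>2)"
  define v where "v k = nu \<alpha> (z * (q\<^sup>2) ^ k) q" for k
  have Q: "norm (q\<^sup>2) < 1"
    using assms(1) by (rule norm_square_less_one)
  have odd_power: "q ^ (2 * m + 1) = q * (q\<^sup>2) ^ m" for m
    unfolding power_add power_mult by simp
  have nzA: "- z * q * (q\<^sup>2) ^ m \<noteq> 1" for m
    using assms(3)[of m] unfolding odd_power by (simp add: mult.assoc)
  have nzb: "b * (q\<^sup>2) ^ m \<noteq> 1" for m
    using assms(2) assms(4)[of m] unfolding odd_power by (simp add: b_def mult.assoc)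
  have P_nz: "P k \<noteq> 0" for k
    using qpoch_nonzero[OF nzA] qpoch_nonzero[OF nzb] by (simp add: P_def)
  have "P \<longlonglongrightarrow> L"
    unfolding P_def[abs_def] L_def by (intro tendsto_mult qpoch_tendsto Q)
  moreover have "L \<noteq> 0"
    unfolding L_def using qpoch_inf_nonzero[OF Q nzA] qpoch_inf_nonzero[OF Q nzb] by simp
  moreover have "v \<longlonglongrightarrow> S"
    unfolding v_def[abs_def] S_def using assms(1) nzA by (rule nu_tendsto)
  ultimately have "(\<lambda>k. v k / P k) \<longlonglongrightarrow> S / L"
    by (intro tendsto_divide)
  then have tele: "(\<lambda>k. v (Suc k) / P (Suc k) - v k / P k) sums (S / L - v 0 / P 0)"
    by (rule telescope_sums)
  have step: "v (Suc k) / P (Suc k) - v k / P k = b * ((q\<^sup>2) ^ k / P (Suc k))" for k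
  proof -
    define f where "f = (1 + z * q * (q\<^sup>2) ^ k) * (1 - b * (q\<^sup>2) ^ k)"
    have nz: "- (z * (q\<^sup>2) ^ k) * q * (q\<^sup>2) ^ m \<noteq> 1" for m
      using nzA[of "k + m"] by (simp add: power_add mult_ac)
    have v: "v (Suc k) = f * v k + b * (q\<^sup>2) ^ k"
      using nu_shift[OF assms(1,2) nz] by (simp add: v_def f_def b_def mult_ac)
    have P: "P (Suc k) = P k * f"
      by (simp add: P_def f_def qpoch_Suc)
    have "f \<noteq> 0"
      using P P_nz[of "Suc k"] by auto
    then show ?thesis
      using P_nz[of k] by (simp add: v P field_simps)
  qed
  have sums: "(\<lambda>k. b * ((q\<^sup>2) ^ k / P (Suc k))) sums (S / L - nu \<alpha> z q)"
    using tele unfolding step by (simp add: v_def P_def qpoch_def)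
  have omega: "omega1 \<alpha> z q = (\<Sum>k. (q\<^sup>2) ^ k / P (Suc k))"
    by (simp add: omega1_def P_def b_def power_mult)
  \<comment> \<open>The telescoped sum gives the convergence of \<open>\<omega>\<^sub>1\<close> when \<open>b \<noteq> 0\<close>; when \<open>b = 0\<close> the product
    with \<open>b\<close> vanishes, whatever the value of the series.\<close>
  have "b * omega1 \<alpha> z q = S / L - nu \<alpha> z q"
  proof (cases "b = 0")
    case True
    then show ?thesis
      using sums_unique[OF sums] by simp
  next
    case False
    then have "summable (\<lambda>k. (q\<^sup>2) ^ k / P (Suc k))"
      using sums_summable[OF sums] by (simp only: summable_cmult_iff simp_thms)
    then show ?thesis
      unfolding omega by (intro sums_unique2[OF sums_mult[OF summable_sums] sums])
  qed
  then show ?thesis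
    by (simp add: b_def S_def L_def)
qed

end
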